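(* Let $n\ge 2$, and let $\mathcal{G}_n$ be the graph with vertex set the unit sphere $S^{n-1}\subset\mathbb{R}^n$ in which distinct $u,v\in S^{n-1}$ are adjacent if and only if $u^\top v>\tfrac12$. Let $\kappa_n$ be the kissing number in dimension $n$. For $r\ge0$ let $\gamma_r(\mathcal{G}_n)$ be the infimum of $\lambda$ over all $\lambda\in\mathbb{R}$ and $K\in\mathcal{C}^{S^{n-1}}_r$ such that $K(v,v)=\lambda-1$ for all $v\in S^{n-1}$ and $K(u,v)=-1$ for all distinct non-adjacent $u,v\in S^{n-1}$, and let $\nu_r(\mathcal{G}_n)$ be the infimum defined in the same way with $Q^{S^{n-1}}_r$ in place of $\mathcal{C}^{S^{n-1}}_r$. Then $\gamma_r(\mathcal{G}_n)\downarrow\kappa_n$ and $\nu_r(\mathcal{G}_n)\downarrow\kappa_n$ as $r\to\infty$ (that is, both sequences are nonincreasing and converge to $\kappa_n$).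
   Context: The kissing number $\kappa_n$ is the maximum number of non-overlapping unit spheres in $\mathbb{R}^n$ that can simultaneously touch another unit sphere; equivalently, the maximum number of points of $S^{n-1}$ with pairwise inner products at most $\tfrac12$, i.e. the stability number of $\mathcal{G}_n$. The infimum over an empty feasible set is $+\infty$. For a compact set $V$, $\mathcal{K}(V)$ denotes the set of kernels on $V$: continuous functions $F:V\times V\to\mathbb{R}$ with $F(x,y)=F(y,x)$ for all $x,y\in V$. A kernel $K\in\mathcal{K}(V)$ is PSD if for every finite $U\subset V$ the matrix obtained by restricting $K$ to $U\times U$ is positive semidefinite; $\mathrm{PSD}(V)$ denotes the set of PSD kernels on $V$. A tensor of order $r$ over $V$ is a function $V^r\to\mathbb{R}$ (not necessarily continuous); $\mathcal{T}^V_r$ is the set of these, and $\mathcal{N}^V_r$ is the set of those that are nonnegative everywhere. A kernel is regarded as a tensor of order $2$. For $r\ge 0$, the stack operator $\mathbf{Stk}^r:\mathcal{T}^V_d\to\mathcal{T}^V_{d+r}$ is $\mathbf{Stk}^r(T)(u,v)=T(u)$ for $u\in V^d$, $v\in V^r$. The symmetrization $\sigma:\mathcal{T}^V_d\to\mathcal{T}^V_d$ is $\sigma(T)(v)=\frac{1}{d!}\sum_{\pi\in Sym(d)}T(\pi v)$, where $Sym(d)$ is the group of permutations of $d$ elements and $\pi v=(v_{\pi(1)},\dots,v_{\pi(d)})$. A tensor $F\in\mathcal{T}^V_{r+2}$ is 2-PSD on $V$ if it is continuous and for all $z\in V^r$, $F(\cdot,\cdot,z)\in\mathrm{PSD}(V)$.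 For an integer $r\ge 0$: $\mathcal{C}^V_r=\{M\in\mathcal{K}(V):\ \sigma(\mathbf{Stk}^r(M))=\sigma(N)\text{ for some }N\in\mathcal{N}^V_{r+2}\}$, and $Q^V_r=\{M\in\mathcal{K}(V):\ \sigma(\mathbf{Stk}^r(M))=\sigma(N)+\sigma(S)\text{ for some }N\in\mathcal{N}^V_{r+2}\text{ and some 2-PSD }S\in\mathcal{T}^V_{r+2}\}$. *)

theory Defs
  imports "HOL-Analysis.Analysis" "HOL-Combinatorics.Permutations"
begin

text \<open>
  Points of \<open>V^d\<close> are functions on \<open>{..<d}\<close>, extended by \<^const>\<open>undefined\<close>; indices are 0-based.
  An order-\<open>d\<close> tensor over \<open>V\<close> is any function \<open>(nat \<Rightarrow> 'a) \<Rightarrow> real\<close>, of which only the values on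
  \<open>tuples V d\<close> matter: nonnegativity, continuity and equality of tensors are always required on
  \<open>tuples V d\<close> only.  The subspace topology that \<open>tuples V d\<close> inherits from \<open>nat \<Rightarrow> 'a\<close> is the product
  topology of \<open>V^d\<close>.
\<close>

definition tuples :: "'a set \<Rightarrow> nat \<Rightarrow> (nat \<Rightarrow> 'a) set" where
  "tuples V d = {..<d} \<rightarrow>\<^sub>E V"

type_synonym 'a tensor = "(nat \<Rightarrow> 'a) \<Rightarrow> real"

definition kernels :: "'a::topological_space set \<Rightarrow> ('a \<Rightarrow> 'a \<Rightarrow> real) set" where
  "kernels V = {F. continuous_on (V \<times> V) (\<lambda>(x, y). F x y) \<and> (\<forall>x\<in>V. \<forall>y\<in>V. F x y = F y x)}"

definition PSD :: "'a::topological_space set \<Rightarrow> ('a \<Rightarrow> 'a \<Rightarrow> real) set" where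
  "PSD V = {K \<in> kernels V. \<forall>U. finite U \<and> U \<subseteq> V \<longrightarrow>
     (\<forall>c :: 'a \<Rightarrow> real. 0 \<le> (\<Sum>x\<in>U. \<Sum>y\<in>U. c x * K x y * c y))}"

definition nonneg_tensors :: "'a set \<Rightarrow> nat \<Rightarrow> 'a tensor set" where
  "nonneg_tensors V d = {N. \<forall>x\<in>tuples V d. 0 \<le> N x}"

definition kernel_tensor :: "('a \<Rightarrow> 'a \<Rightarrow> real) \<Rightarrow> 'a tensor" where
  "kernel_tensor K x = K (x 0) (x 1)"

text \<open>
  The stack of an order-\<open>d\<close> tensor, evaluated at a tuple of any length \<open>d + r\<close>, reads the first \<open>d\<close>
  entries; the formula does not depend on \<open>r\<close>.
\<close>

definition stk :: "nat \<Rightarrow> 'a tensor \<Rightarrow> 'a tensor" where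
  "stk d T x = T (restrict x {..<d})"

definition symmetrize :: "nat \<Rightarrow> 'a tensor \<Rightarrow> 'a tensor" where
  "symmetrize d T v = (\<Sum>\<pi> | \<pi> permutes {..<d}. T (v \<circ> \<pi>)) / fact d"

text \<open>
  For \<open>z \<in> tuples V r\<close>, the tuple \<open>(x, y, z) \<in> tuples V (r + 2)\<close> is
  \<open>case_nat x (case_nat y z)\<close>.
\<close>

definition two_psd :: "'a::topological_space set \<Rightarrow> nat \<Rightarrow> 'a tensor set" where
  "two_psd V r = {F. continuous_on (tuples V (r + 2)) F \<and>
     (\<forall>z\<in>tuples V r. (\<lambda>x y. F (case_nat x (case_nat y z))) \<in> PSD V)}"

definition cone_C :: "'a::topological_space set \<Rightarrow> nat \<Rightarrow> ('a \<Rightarrow> 'a \<Rightarrow> real) set" where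
  "cone_C V r = {M \<in> kernels V. \<exists>N\<in>nonneg_tensors V (r + 2). \<forall>x\<in>tuples V (r + 2).
     symmetrize (r + 2) (stk 2 (kernel_tensor M)) x = symmetrize (r + 2) N x}"

definition cone_Q :: "'a::topological_space set \<Rightarrow> nat \<Rightarrow> ('a \<Rightarrow> 'a \<Rightarrow> real) set" where
  "cone_Q V r = {M \<in> kernels V. \<exists>N\<in>nonneg_tensors V (r + 2). \<exists>S\<in>two_psd V r.
     \<forall>x\<in>tuples V (r + 2).
       symmetrize (r + 2) (stk 2 (kernel_tensor M)) x
         = symmetrize (r + 2) N x + symmetrize (r + 2) S x}"

text \<open>Infima are taken in \<^typ>\<open>ereal\<close>, so that an infeasible problem has value \<open>\<infinity>\<close>.\<close>

definition stability_bound ::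
    "'a set \<Rightarrow> ('a \<Rightarrow> 'a \<Rightarrow> bool) \<Rightarrow> ('a \<Rightarrow> 'a \<Rightarrow> real) set \<Rightarrow> ereal" where
  "stability_bound V adj \<K> = Inf {ereal l | l. \<exists>K\<in>\<K>.
     (\<forall>v\<in>V. K v v = l - 1) \<and>
     (\<forall>u\<in>V. \<forall>v\<in>V. u \<noteq> v \<and> \<not> adj u v \<longrightarrow> K u v = -1)}"

definition gamma_bound :: "'a::topological_space set \<Rightarrow> ('a \<Rightarrow> 'a \<Rightarrow> bool) \<Rightarrow> nat \<Rightarrow> ereal" where
  "gamma_bound V adj r = stability_bound V adj (cone_C V r)"

definition nu_bound :: "'a::topological_space set \<Rightarrow> ('a \<Rightarrow> 'a \<Rightarrow> bool) \<Rightarrow> nat \<Rightarrow> ereal" where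
  "nu_bound V adj r = stability_bound V adj (cone_Q V r)"

definition sphere_adj :: "'a::euclidean_space \<Rightarrow> 'a \<Rightarrow> bool" where
  "sphere_adj u v \<longleftrightarrow> u \<in> sphere 0 1 \<and> v \<in> sphere 0 1 \<and> u \<noteq> v \<and> u \<bullet> v > 1/2"

text \<open>
  A kissing configuration is given by the set of centres of its unit spheres; the central unit
  sphere is centred at the origin.  Spheres do not overlap when the open balls they bound are
  disjoint.
\<close>

definition kissing_configuration :: "'a::euclidean_space set \<Rightarrow> bool" where
  "kissing_configuration A \<longleftrightarrow> finite A \<and>
     (\<forall>a\<in>A. sphere a 1 \<inter> sphere 0 1 \<noteq> {} \<and> ball a 1 \<inter> ball 0 1 = {}) \<and>
     (\<forall>a\<in>A. \<forall>b\<in>A. a \<noteq> b \<longrightarrow> ball a 1 \<inter> ball b 1 = {})"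

text \<open>The maximum exists: the centres lie on a sphere of radius 2 and have mutual distance at least 2.\<close>

definition kissing_number :: "'a::euclidean_space itself \<Rightarrow> nat" where
  "kissing_number _ = Max {card A | A :: 'a set. kissing_configuration A}"

end

theory Submission
  imports Defs
begin

text \<open>
  Lower bound: summing the defining identity of \<^const>\<open>cone_Q\<close> over all tuples in a stable set \<open>A\<close>
  shows that the entries of a feasible kernel on \<open>A \<times> A\<close> have a nonnegative sum, that is,
  \<open>card A \<le> \<lambda>\<close>.  Upper bound: membership in \<^const>\<open>cone_C\<close> at level \<open>r\<close> amounts to
  \<open>\<Sum>\<^bsub>i \<noteq> j\<^esub> K(x\<^sub>i, x\<^sub>j) \<ge> 0\<close> for all \<open>r + 2\<close> points, and a continuous approximation of the
  Motzkin--Straus kernel with \<open>\<lambda>\<close> slightly above the kissing number satisfies this for large \<open>r\<close>, by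
  Turan's inequality.
\<close>

section \<open>Tuples, stacking and symmetrization\<close>

lemma comp_permutes_tuples:
  assumes "x \<in> tuples V d" "\<pi> permutes {..<d}"
  shows "x \<circ> \<pi> \<in> tuples V d"
  unfolding tuples_def
proof (rule PiE_I)
  fix i assume "i \<in> {..<d}"
  then show "(x \<circ> \<pi>) i \<in> V"
    using assms(1) permutes_in_image[OF assms(2), of i] by (auto simp: tuples_def)
next
  fix i assume "i \<notin> {..<d}"
  then show "(x \<circ> \<pi>) i = undefined"
    using assms(1) permutes_not_in[OF assms(2), of i] by (auto simp: tuples_def)
qed

lemma case_nat_tuples: "a \<in> V \<Longrightarrow> z \<in> tuples V d \<Longrightarrow> case_nat a z \<in> tuples V (Suc d)"
  unfolding tuples_def by (rule PiE_I) (auto split: nat.splits)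

lemma finite_tuples: "finite A \<Longrightarrow> finite (tuples A d)"
  unfolding tuples_def by (rule finite_PiE[OF finite_lessThan])

text \<open>Peeling off the first entry twice separates the two kernel arguments of a tensor from
  its parameter tuple \<open>z\<close>.\<close>

lemma sum_tuples_Suc:
  "(\<Sum>x\<in>tuples A (Suc d). f x) = (\<Sum>a\<in>A. \<Sum>z\<in>tuples A d. f (case_nat a z))"
proof -
  have "(\<Sum>x\<in>tuples A (Suc d). f x) = (\<Sum>(a, z)\<in>A \<times> tuples A d. f (case_nat a z))"
  proof (rule sum.reindex_bij_witness[where i = "\<lambda>(a, z). case_nat a z"
        and j = "\<lambda>x. (x 0, x \<circ> Suc)"])
    fix x assume "x \<in> tuples A (Suc d)"
    then show "(x 0, x \<circ> Suc) \<in> A \<times> tuples A d"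
      by (auto simp: tuples_def PiE_iff extensional_def)
    show "(case (x 0, x \<circ> Suc) of (a, z) \<Rightarrow> case_nat a z) = x"
      by (auto simp: fun_eq_iff split: nat.split)
    then show "(case (x 0, x \<circ> Suc) of (a, z) \<Rightarrow> f (case_nat a z)) = f x"
      by simp
  qed (auto simp: case_nat_tuples fun_eq_iff)
  then show ?thesis
    by (simp add: sum.cartesian_product)
qed

lemma stk_kernel_tensor: "stk 2 (kernel_tensor K) x = K (x 0) (x 1)"
  by (simp add: stk_def kernel_tensor_def)

lemma stk_stk: "m \<le> n \<Longrightarrow> stk n (stk m T) = stk m T"
  by (auto simp: stk_def fun_eq_iff Int_absorb1 restrict_restrict)

lemma symmetrize_comp_permutes:
  assumes "\<rho> permutes {..<d}"
  shows "symmetrize d T (x \<circ> \<rho>) = symmetrize d T x"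
proof -
  have "(\<Sum>\<pi> | \<pi> permutes {..<d}. T (x \<circ> \<pi>)) = (\<Sum>\<pi> | \<pi> permutes {..<d}. T (x \<circ> (\<rho> \<circ> \<pi>)))"
    using setum_permutations_compose_left[OF assms, of "\<lambda>\<pi>. T (x \<circ> \<pi>)"] by simp
  then show ?thesis
    by (simp add: symmetrize_def comp_assoc)
qed

lemma symmetrize_idem: "symmetrize d (symmetrize d T) x = symmetrize d T x"
proof -
  have "(\<Sum>\<pi> | \<pi> permutes {..<d}. symmetrize d T (x \<circ> \<pi>)) = fact d * symmetrize d T x"
    by (simp add: symmetrize_comp_permutes card_permutations)
  then show ?thesis
    by (simp add: symmetrize_def[of d "symmetrize d T"])
qed

lemma symmetrize_cong:
  assumes "\<And>y. y \<in> tuples V d \<Longrightarrow> S y = T y" "x \<in> tuples V d"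
  shows "symmetrize d S x = symmetrize d T x"
proof -
  have "(\<Sum>\<pi> | \<pi> permutes {..<d}. S (x \<circ> \<pi>)) = (\<Sum>\<pi> | \<pi> permutes {..<d}. T (x \<circ> \<pi>))"
    using comp_permutes_tuples[OF assms(2)] assms(1) by (intro sum.cong refl) blast
  then show ?thesis
    by (simp only: symmetrize_def)
qed

lemma symmetrize_add: "symmetrize d (\<lambda>y. S y + T y) x = symmetrize d S x + symmetrize d T x"
  by (simp add: symmetrize_def sum.distrib add_divide_distrib)

text \<open>A permutation of the first \<open>d\<close> indices is also one of \<open>Suc d\<close>
  indices, so the outer average absorbs it. Hence every inner summand yields the same outer sum, and
  averaging over the inner permutations changes nothing.\<close>

lemma symmetrize_stk_symmetrize:
  "symmetrize (Suc d) (stk d (symmetrize d T)) x = symmetrize (Suc d) (stk d T) x"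
proof -
  let ?P = "{\<pi>. \<pi> permutes {..<Suc d}}"
  have inv: "(\<Sum>\<pi>\<in>?P. T (restrict (x \<circ> \<pi>) {..<d} \<circ> \<rho>)) = (\<Sum>\<pi>\<in>?P. T (restrict (x \<circ> \<pi>) {..<d}))"
    if \<rho>: "\<rho> permutes {..<d}" for \<rho>
  proof -
    have eq: "restrict (x \<circ> \<pi>) {..<d} \<circ> \<rho> = restrict (x \<circ> (\<pi> \<circ> \<rho>)) {..<d}" for \<pi>
      using permutes_in_image[OF \<rho>] by (auto simp: fun_eq_iff)
    have \<rho>': "\<rho> permutes {..<Suc d}"
      using \<rho> by (rule permutes_subset) auto
    show ?thesis
      unfolding eq
      using sum_permutations_compose_right[OF \<rho>', of "\<lambda>\<pi>. T (restrict (x \<circ> \<pi>) {..<d})"] by simp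
  qed
  have "(\<Sum>\<pi>\<in>?P. symmetrize d T (restrict (x \<circ> \<pi>) {..<d}))
      = (\<Sum>\<rho> | \<rho> permutes {..<d}. \<Sum>\<pi>\<in>?P. T (restrict (x \<circ> \<pi>) {..<d} \<circ> \<rho>)) / fact d"
    unfolding symmetrize_def sum_divide_distrib[symmetric] by (subst sum.swap) simp
  also have "\<dots> = (\<Sum>\<rho> | \<rho> permutes {..<d}. \<Sum>\<pi>\<in>?P. T (restrict (x \<circ> \<pi>) {..<d})) / fact d"
    by (intro arg_cong[where f = "\<lambda>s. s / fact d"] sum.cong inv) auto
  also have "\<dots> = (\<Sum>\<pi>\<in>?P. T (restrict (x \<circ> \<pi>) {..<d}))"
    by (simp add: card_permutations)
  finally show ?thesis
    by (simp add: symmetrize_def[of "Suc d"] stk_def)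
qed

text \<open>The index set \<open>tuples A d\<close> is invariant under permuting entries, so each of
  the \<open>fact d\<close> permutations contributes the same sum.\<close>

lemma sum_tuples_symmetrize:
  "(\<Sum>x\<in>tuples A d. symmetrize d T x) = (\<Sum>x\<in>tuples A d. T x)"
proof -
  have inv: "(\<Sum>x\<in>tuples A d. T (x \<circ> \<pi>)) = (\<Sum>x\<in>tuples A d. T x)"
    if \<pi>: "\<pi> permutes {..<d}" for \<pi>
    by (rule sum.reindex_bij_witness[where i = "\<lambda>x. x \<circ> inv \<pi>" and j = "\<lambda>x. x \<circ> \<pi>"])
      (auto simp: comp_permutes_tuples permutes_inv \<pi> comp_assoc permutes_inv_o[OF \<pi>])
  have "(\<Sum>x\<in>tuples A d. symmetrize d T x)
      = (\<Sum>\<pi> | \<pi> permutes {..<d}. \<Sum>x\<in>tuples A d. T (x \<circ> \<pi>)) / fact d"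
    unfolding symmetrize_def sum_divide_distrib[symmetric] by (subst sum.swap) simp
  also have "\<dots> = (\<Sum>x\<in>tuples A d. T x)"
    by (simp add: inv card_permutations)
  finally show ?thesis .
qed

section \<open>Inclusions between the cones\<close>

lemma restrict_tuples: "x \<in> tuples V n \<Longrightarrow> d \<le> n \<Longrightarrow> restrict x {..<d} \<in> tuples V d"
  by (auto simp: tuples_def PiE_iff)

lemma stk_nonneg_tensors: "N \<in> nonneg_tensors V d \<Longrightarrow> stk d N \<in> nonneg_tensors V (Suc d)"
  by (simp add: nonneg_tensors_def stk_def restrict_tuples[of _ V "Suc d"])

text \<open>The extra entry only lengthens the parameter tuple, so every slice of the stack is a
  slice of \<open>S\<close>. Restriction is continuous because each of its coordinates is a
  projection or the constant \<open>undefined\<close>.\<close>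

lemma stk_two_psd:
  assumes S: "S \<in> two_psd V r"
  shows "stk (r + 2) S \<in> two_psd V (Suc r)"
proof -
  have cont: "continuous_on UNIV (\<lambda>x :: nat \<Rightarrow> 'a. restrict x {..<r + 2})"
  proof (rule continuous_on_coordinatewise_then_product)
    show "continuous_on UNIV (\<lambda>x :: nat \<Rightarrow> 'a. restrict x {..<r + 2} i)" for i
      by (cases "i < r + 2") auto
  qed
  have "continuous_on (tuples V (Suc r + 2)) (\<lambda>x. S (restrict x {..<r + 2}))"
    using S by (intro continuous_on_compose2[OF _ continuous_on_subset[OF cont]])
      (auto simp: two_psd_def intro: restrict_tuples)
  moreover have "restrict (case_nat x (case_nat y z)) {..<r + 2}
      = case_nat x (case_nat y (restrict z {..<r}))" for x y :: 'a and z
    by (auto simp: fun_eq_iff split: nat.split)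
  ultimately show ?thesis
    using S restrict_tuples[of _ V "Suc r" r] by (auto simp: two_psd_def stk_def)
qed

text \<open>The level-\<open>r\<close> identity is stacked by one entry and symmetrized again;
  \<open>symmetrize_stk_symmetrize\<close> then erases the inner symmetrizations, leaving
  \<open>stk (r + 2) N\<close> as the new witness.\<close>

lemma cone_C_Suc: "cone_C V r \<subseteq> cone_C V (Suc r)"
proof
  fix M assume "M \<in> cone_C V r"
  then obtain N where M: "M \<in> kernels V" and N: "N \<in> nonneg_tensors V (r + 2)"
    and eq: "\<And>x. x \<in> tuples V (r + 2) \<Longrightarrow>
      symmetrize (r + 2) (stk 2 (kernel_tensor M)) x = symmetrize (r + 2) N x"
    unfolding cone_C_def by auto
  have "symmetrize (Suc (r + 2)) (stk 2 (kernel_tensor M)) x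
      = symmetrize (Suc (r + 2)) (stk (r + 2) N) x" if "x \<in> tuples V (Suc (r + 2))" for x
  proof -
    have "symmetrize (Suc (r + 2)) (stk (r + 2) (symmetrize (r + 2) (stk 2 (kernel_tensor M)))) x
        = symmetrize (Suc (r + 2)) (stk (r + 2) (symmetrize (r + 2) N)) x"
      by (rule symmetrize_cong[OF _ that]) (simp only: stk_def eq[OF restrict_tuples[OF _ le_SucI[OF order_refl]]])
    then show ?thesis
      by (simp only: symmetrize_stk_symmetrize stk_stk[of 2 "r + 2"] le_add2)
  qed
  then show "M \<in> cone_C V (Suc r)"
    using M stk_nonneg_tensors[OF N] unfolding cone_C_def by auto
qed

lemma cone_Q_Suc: "cone_Q V r \<subseteq> cone_Q V (Suc r)"
proof
  fix M assume "M \<in> cone_Q V r"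
  then obtain N S where M: "M \<in> kernels V" and N: "N \<in> nonneg_tensors V (r + 2)"
    and S: "S \<in> two_psd V r"
    and eq: "\<And>x. x \<in> tuples V (r + 2) \<Longrightarrow>
      symmetrize (r + 2) (stk 2 (kernel_tensor M)) x = symmetrize (r + 2) N x + symmetrize (r + 2) S x"
    unfolding cone_Q_def by auto
  have "symmetrize (Suc (r + 2)) (stk 2 (kernel_tensor M)) x
      = symmetrize (Suc (r + 2)) (stk (r + 2) N) x + symmetrize (Suc (r + 2)) (stk (r + 2) S) x"
    if "x \<in> tuples V (Suc (r + 2))" for x
  proof -
    have "symmetrize (Suc (r + 2)) (stk (r + 2) (symmetrize (r + 2) (stk 2 (kernel_tensor M)))) x
        = symmetrize (Suc (r + 2)) (\<lambda>y. stk (r + 2) (symmetrize (r + 2) N) y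
            + stk (r + 2) (symmetrize (r + 2) S) y) x"
      by (rule symmetrize_cong[OF _ that]) (simp only: stk_def eq[OF restrict_tuples[OF _ le_SucI[OF order_refl]]])
    then show ?thesis
      by (simp only: symmetrize_add symmetrize_stk_symmetrize stk_stk[of 2 "r + 2"] le_add2)
  qed
  then show "M \<in> cone_Q V (Suc r)"
    using M stk_nonneg_tensors[OF N] stk_two_psd[OF S] unfolding cone_Q_def by auto
qed

lemma cone_C_subset_cone_Q: "cone_C V r \<subseteq> cone_Q V r"
proof -
  have "(\<lambda>_. 0) \<in> two_psd V r"
    by (auto simp: two_psd_def PSD_def kernels_def)
  moreover have "symmetrize d (\<lambda>_. 0) x = 0" for d and x :: "nat \<Rightarrow> 'a"
    by (simp add: symmetrize_def)
  ultimately show ?thesis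
    unfolding cone_C_def cone_Q_def
    by (smt (verit, ccfv_threshold) add.right_neutral mem_Collect_eq subsetI)
qed

section \<open>A necessary condition for \<open>cone_Q\<close> and a sufficient one for
  \<open>cone_C\<close>\<close>

lemma cone_Q_sum_nonneg:
  assumes K: "K \<in> cone_Q V r" and A: "finite A" "A \<noteq> {}" "A \<subseteq> V"
  shows "0 \<le> (\<Sum>a\<in>A. \<Sum>b\<in>A. K a b)"
proof -
  obtain N S where N: "N \<in> nonneg_tensors V (r + 2)" and S: "S \<in> two_psd V r"
    and eq: "\<And>x. x \<in> tuples V (r + 2) \<Longrightarrow>
      symmetrize (r + 2) (stk 2 (kernel_tensor K)) x = symmetrize (r + 2) N x + symmetrize (r + 2) S x"
    using K unfolding cone_Q_def by auto
  have sub: "tuples A d \<subseteq> tuples V d" for d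
    using A(3) by (auto simp: tuples_def PiE_iff)
  have split: "(\<Sum>x\<in>tuples A (r + 2). T x)
      = (\<Sum>z\<in>tuples A r. \<Sum>a\<in>A. \<Sum>b\<in>A. T (case_nat a (case_nat b z)))" for T :: "'a tensor"
  proof -
    have "(\<Sum>x\<in>tuples A (r + 2). T x)
        = (\<Sum>a\<in>A. \<Sum>b\<in>A. \<Sum>z\<in>tuples A r. T (case_nat a (case_nat b z)))"
      by (simp add: sum_tuples_Suc)
    also have "\<dots> = (\<Sum>a\<in>A. \<Sum>z\<in>tuples A r. \<Sum>b\<in>A. T (case_nat a (case_nat b z)))"
      by (rule sum.cong[OF refl], rule sum.swap)
    also have "\<dots> = (\<Sum>z\<in>tuples A r. \<Sum>a\<in>A. \<Sum>b\<in>A. T (case_nat a (case_nat b z)))"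
      by (rule sum.swap)
    finally show ?thesis .
  qed
  have "(\<Sum>x\<in>tuples A (r + 2). stk 2 (kernel_tensor K) x)
      = (\<Sum>x\<in>tuples A (r + 2). symmetrize (r + 2) N x + symmetrize (r + 2) S x)"
    unfolding sum_tuples_symmetrize[of "r + 2" "stk 2 (kernel_tensor K)", symmetric]
    using sub by (intro sum.cong eq) auto
  also have "\<dots> = (\<Sum>x\<in>tuples A (r + 2). N x) + (\<Sum>x\<in>tuples A (r + 2). S x)"
    by (simp add: sum.distrib sum_tuples_symmetrize)
  also have "\<dots> \<ge> 0"
  proof -
    have "0 \<le> (\<Sum>x\<in>tuples A (r + 2). N x)"
      using N sub by (intro sum_nonneg) (auto simp: nonneg_tensors_def)
    moreover have "0 \<le> (\<Sum>a\<in>A. \<Sum>b\<in>A. S (case_nat a (case_nat b z)))"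
      if z: "z \<in> tuples A r" for z
    proof -
      have "(\<lambda>a b. S (case_nat a (case_nat b z))) \<in> PSD V"
        using S z sub by (auto simp: two_psd_def)
      then show ?thesis
        \<comment> \<open>With all weights equal to 1, the quadratic form of the slice at
          \<open>z\<close> is its plain sum over \<open>A \<times> A\<close>.\<close>
        using A by (auto simp: PSD_def dest!: spec[where x = A] spec[where x = "\<lambda>_. 1"])
    qed
    then have "0 \<le> (\<Sum>x\<in>tuples A (r + 2). S x)"
      unfolding split by (rule sum_nonneg)
    ultimately show ?thesis by simp
  qed
  \<comment> \<open>The stacked kernel ignores \<open>z\<close>, so each \<open>z\<close>
    contributes the same double sum.\<close>
  finally have "0 \<le> real (card (tuples A r)) * (\<Sum>a\<in>A. \<Sum>b\<in>A. K a b)"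
    unfolding split by (simp add: stk_kernel_tensor)
  moreover have "0 < card (tuples A r)"
    using A by (auto simp: card_gt_0_iff finite_tuples) (auto simp: tuples_def PiE_eq_empty_iff)
  ultimately show ?thesis
    by (simp add: zero_le_mult_iff)
qed

text \<open>
  Every value of the symmetrized tensor averages the off-diagonal sums of \<open>K\<close>, whence the tensor
  itself can be taken as the nonnegative one in the definition of \<^const>\<open>cone_C\<close>.
\<close>

lemma cone_C_I:
  assumes K: "K \<in> kernels V"
    and nonneg: "\<And>x. x \<in> tuples V (r + 2) \<Longrightarrow> 0 \<le> (\<Sum>i<r + 2. \<Sum>j\<in>{..<r + 2} - {i}. K (x i) (x j))"
  shows "K \<in> cone_C V r"
proof -
  define d where "d = r + 2"
  let ?T = "stk 2 (kernel_tensor K)"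
  let ?P = "{\<pi>. \<pi> permutes {..<d}}"
  have "0 \<le> symmetrize d ?T x" if x: "x \<in> tuples V d" for x
  proof -
    let ?s = "\<Sum>\<pi>\<in>?P. K (x (\<pi> 0)) (x (\<pi> 1))"
    have eq: "(\<Sum>\<pi>\<in>?P. K (x (\<pi> i)) (x (\<pi> j))) = ?s" if ij: "i < d" "j < d" "i \<noteq> j" for i j
    proof -
      \<comment> \<open>The permutation is to send 0 to \<open>i\<close> and 1 to \<open>j\<close>.
        The first swap moves 0 to \<open>i\<close> and 1 to \<open>k\<close>; the second moves
        \<open>k\<close> to \<open>j\<close> and fixes \<open>i\<close>, since \<open>i\<close>
        differs from both.\<close>
      define k where "k = Transposition.transpose 0 i 1"
      define \<rho> where "\<rho> = Transposition.transpose k j \<circ> Transposition.transpose 0 i"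
      have k: "k < d" "k \<noteq> i" "Transposition.transpose 0 i 1 = k"
        using ij by (auto simp: k_def Transposition.transpose_def d_def)
      have "\<rho> permutes {..<d}"
        unfolding \<rho>_def using ij k by (intro permutes_compose permutes_swap_id) auto
      moreover have "\<rho> 0 = i" "\<rho> 1 = j"
        using ij k by (auto simp: \<rho>_def transpose_apply_other simp del: One_nat_def)
      ultimately show ?thesis
        using sum_permutations_compose_right[of \<rho> "{..<d}" "\<lambda>\<pi>. K (x (\<pi> 0)) (x (\<pi> 1))"] by simp
    qed
    \<comment> \<open>The hypothesis is applied to every rearrangement of \<open>x\<close>. After
      the sums are exchanged, each of the \<open>d * (d - 1)\<close> ordered index pairs contributes
      \<open>?s\<close>.\<close>
    have "0 \<le> (\<Sum>\<pi>\<in>?P. \<Sum>i<d. \<Sum>j\<in>{..<d} - {i}. K (x (\<pi> i)) (x (\<pi> j)))"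
    proof (rule sum_nonneg)
      fix \<pi> assume "\<pi> \<in> ?P"
      then show "0 \<le> (\<Sum>i<d. \<Sum>j\<in>{..<d} - {i}. K (x (\<pi> i)) (x (\<pi> j)))"
        using nonneg[of "x \<circ> \<pi>"] comp_permutes_tuples[OF x] unfolding d_def by (simp only: mem_Collect_eq comp_apply)
    qed
    also have "\<dots> = (\<Sum>i<d. \<Sum>\<pi>\<in>?P. \<Sum>j\<in>{..<d} - {i}. K (x (\<pi> i)) (x (\<pi> j)))"
      by (rule sum.swap)
    also have "\<dots> = (\<Sum>i<d. \<Sum>j\<in>{..<d} - {i}. \<Sum>\<pi>\<in>?P. K (x (\<pi> i)) (x (\<pi> j)))"
      by (rule sum.cong[OF refl], rule sum.swap)
    also have "\<dots> = (\<Sum>i<d. \<Sum>j\<in>{..<d} - {i}. ?s)"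
      by (rule sum.cong[OF refl], rule sum.cong[OF refl], rule eq) auto
    also have "\<dots> = real (d * (d - 1)) * ?s"
      by (simp add: d_def algebra_simps)
    finally have "0 \<le> real (d * (d - 1)) * ?s" .
    moreover have "0 < real (d * (d - 1))"
      unfolding of_nat_0_less_iff by (simp add: d_def)
    ultimately have "0 \<le> ?s"
      by (meson mult_pos_neg not_le)
    then show ?thesis
      by (simp add: symmetrize_def stk_kernel_tensor)
  qed
  then have "symmetrize (r + 2) ?T \<in> nonneg_tensors V (r + 2)"
    unfolding nonneg_tensors_def d_def by blast
  then show ?thesis
    using K unfolding cone_C_def
    by (intro CollectI conjI bexI[of _ "symmetrize (r + 2) ?T"] ballI) (simp_all only: symmetrize_idem)
qed

section \<open>Monotonicity and lower estimate of the bounds\<close>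

lemma stability_bound_antimono: "\<K> \<subseteq> \<L> \<Longrightarrow> stability_bound V adj \<L> \<le> stability_bound V adj \<K>"
  unfolding stability_bound_def
  by (intro Inf_superset_mono Collect_mono impI)
    (elim exE conjE bexE, intro exI conjI bexI[OF _ subsetD], assumption+)

lemma decseq_gamma_bound: "decseq (gamma_bound V adj)"
  unfolding decseq_Suc_iff gamma_bound_def by (intro allI stability_bound_antimono cone_C_Suc)

lemma decseq_nu_bound: "decseq (nu_bound V adj)"
  unfolding decseq_Suc_iff nu_bound_def by (intro allI stability_bound_antimono cone_Q_Suc)

lemma nu_bound_le_gamma_bound: "nu_bound V adj r \<le> gamma_bound V adj r"
  unfolding nu_bound_def gamma_bound_def by (intro stability_bound_antimono cone_C_subset_cone_Q)

lemma card_stable_le_nu_bound: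
  assumes A: "finite A" "A \<noteq> {}" "A \<subseteq> V" "pairwise (\<lambda>u v. \<not> adj u v) A"
  shows "ereal (real (card A)) \<le> nu_bound V adj r"
proof -
  have "real (card A) \<le> l" if K: "K \<in> cone_Q V r" "\<forall>v\<in>V. K v v = l - 1"
    "\<forall>u\<in>V. \<forall>v\<in>V. u \<noteq> v \<and> \<not> adj u v \<longrightarrow> K u v = -1" for K l
  proof -
    \<comment> \<open>The row of \<open>a\<close> has diagonal entry \<open>l - 1\<close> and all
      other entries \<open>-1\<close>, so the total over \<open>A\<close> is
      \<open>card A * (l - card A)\<close>.\<close>
    have row: "(\<Sum>b\<in>A. K a b) = l - card A" if a: "a \<in> A" for a
    proof -
      have "(\<Sum>b\<in>A. K a b) = (\<Sum>b\<in>A. (if b = a then l else 0) - 1)"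
      proof (rule sum.cong[OF refl])
        fix b assume b: "b \<in> A"
        have aV: "a \<in> V" and bV: "b \<in> V"
          using A(3) a b by auto
        show "K a b = (if b = a then l else 0) - 1"
        proof (cases "b = a")
          case True
          then show ?thesis using K(2) aV by simp
        next
          case False
          then have "\<not> adj a b"
            using A(4) a b by (simp add: pairwise_def)
          then show ?thesis
            using K(3)[rule_format, OF aV bV] False by simp
        qed
      qed
      also have "\<dots> = l - card A"
        using A(1) a by (simp add: sum_subtractf sum.delta)
      finally show ?thesis .
    qed
    have "0 \<le> (\<Sum>a\<in>A. \<Sum>b\<in>A. K a b)"
      by (rule cone_Q_sum_nonneg[OF K(1) A(1-3)])
    also have "\<dots> = card A * (l - card A)"
      by (simp add: row)
    finally show ?thesis
      using A(1,2) by (auto simp: zero_le_mult_iff card_gt_0_iff)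
  qed
  then show ?thesis
    unfolding nu_bound_def stability_bound_def by (intro Inf_greatest) auto
qed

section \<open>The inequalities of Caro-Wei and Turan\<close>

text \<open>
  Greedily choose a vertex of minimal degree and delete its closed
  neighbourhood, whose reciprocal degrees add up to at most 1.
\<close>

lemma caro_wei:
  fixes R :: "'b \<Rightarrow> 'b \<Rightarrow> bool"
  assumes "finite I" "\<And>i. i \<in> I \<Longrightarrow> R i i" "\<And>i j. R i j \<Longrightarrow> R j i"
  shows "\<exists>J\<subseteq>I. pairwise (\<lambda>i j. \<not> R i j) J \<and>
    (\<Sum>i\<in>I. 1 / real (card {j \<in> I. R i j})) \<le> real (card J)"
  using assms(1,2)
proof (induction I rule: finite_psubset_induct)
  case (psubset I)
  show ?case
  proof (cases "I = {}")
    case False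
    \<comment> \<open>Since \<open>R\<close> is reflexive on \<open>I\<close>, the degree counts the
      vertex itself and is positive.\<close>
    define deg where "deg = (\<lambda>I i. card {j \<in> I. R i j})"
    obtain v where v: "v \<in> I" "\<And>i. i \<in> I \<Longrightarrow> deg I v \<le> deg I i"
      using ex_has_least_nat[of "\<lambda>i. i \<in> I" _ "deg I"] False by blast
    define D where "D = {j \<in> I. R v j}"
    have D: "D \<subseteq> I" "v \<in> D"
      using v psubset.prems by (auto simp: D_def)
    have finD: "finite D"
      using D psubset.hyps by (auto intro: finite_subset)
    obtain J where J: "J \<subseteq> I - D" "pairwise (\<lambda>i j. \<not> R i j) J"
      "(\<Sum>i\<in>I - D. 1 / real (deg (I - D) i)) \<le> real (card J)"
      using psubset.IH[of "I - D"] psubset.prems D unfolding deg_def by auto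
    have pos: "0 < deg K i" if "K \<subseteq> I" "i \<in> K" for K i
      using that psubset.prems psubset.hyps finite_subset[of K I]
      by (auto simp: deg_def card_gt_0_iff)
    have "(\<Sum>i\<in>I. 1 / real (deg I i)) = (\<Sum>i\<in>I - D. 1 / real (deg I i)) + (\<Sum>i\<in>D. 1 / real (deg I i))"
      using psubset.hyps D by (simp add: sum.subset_diff)
    \<comment> \<open>By minimality of \<open>v\<close>, each of the \<open>deg I v\<close> elements
      of \<open>D\<close> has reciprocal degree at most \<open>1 / deg I v\<close>.\<close>
    also have "(\<Sum>i\<in>D. 1 / real (deg I i)) \<le> (\<Sum>i\<in>D. 1 / real (deg I v))"
      using v D pos[of I v] by (intro sum_mono divide_left_mono mult_pos_pos) (auto intro!: pos)
    also have "\<dots> = 1"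
      using D finD by (auto simp: deg_def simp flip: D_def)
    \<comment> \<open>Deleting vertices can only lower degrees, so the reciprocals grow.\<close>
    also have "(\<Sum>i\<in>I - D. 1 / real (deg I i)) \<le> (\<Sum>i\<in>I - D. 1 / real (deg (I - D) i))"
    proof (intro sum_mono divide_left_mono mult_pos_pos)
      fix i assume "i \<in> I - D"
      show "real (deg (I - D) i) \<le> real (deg I i)"
        unfolding deg_def using psubset.hyps by (intro of_nat_mono card_mono) auto
    qed (auto intro!: pos)
    also have "\<dots> \<le> real (card J)"
      by (rule J(3))
    also have "real (card J) + 1 = real (card (insert v J))"
      using J(1) D psubset.hyps finite_subset[of J I] by (subst card_insert_disjoint) auto
    finally have "(\<Sum>i\<in>I. 1 / real (deg I i)) \<le> real (card (insert v J))"
      by simp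
    moreover have "pairwise (\<lambda>i j. \<not> R i j) (insert v J)"
      using J assms(3) by (auto simp: pairwise_insert D_def)
    ultimately show ?thesis
      using J(1) v(1) unfolding deg_def by (intro exI[of _ "insert v J"]) auto
  qed auto
qed

text \<open>Caro-Wei bounds the sum of the reciprocal degrees by \<open>k\<close>. Cauchy-Schwarz
  for \<open>sqrt (1 / ?d i)\<close> and \<open>sqrt (?d i)\<close>, whose products are 1, turns
  this into a lower bound for the sum of the degrees.\<close>

lemma turan:
  fixes R :: "'b \<Rightarrow> 'b \<Rightarrow> bool"
  assumes I: "finite I" "\<And>i. i \<in> I \<Longrightarrow> R i i" "\<And>i j. R i j \<Longrightarrow> R j i"
    and indep: "\<And>J. J \<subseteq> I \<Longrightarrow> pairwise (\<lambda>i j. \<not> R i j) J \<Longrightarrow> card J \<le> k"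
  shows "(real (card I))\<^sup>2 \<le> real k * (\<Sum>i\<in>I. real (card {j \<in> I. R i j}))"
proof -
  let ?d = "\<lambda>i. real (card {j \<in> I. R i j})"
  have pos: "0 < ?d i" if "i \<in> I" for i
    using that I by (auto simp: card_gt_0_iff)
  obtain J where J: "J \<subseteq> I" "pairwise (\<lambda>i j. \<not> R i j) J" "(\<Sum>i\<in>I. 1 / ?d i) \<le> real (card J)"
    using caro_wei[of I R] I by blast
  have "(\<Sum>i\<in>I. sqrt (1 / ?d i) * sqrt (?d i)) = (\<Sum>i\<in>I. 1)"
    using pos by (intro sum.cong) (auto simp: real_sqrt_mult[symmetric] simp del: real_sqrt_divide)
  then have "(real (card I))\<^sup>2 = (\<Sum>i\<in>I. sqrt (1 / ?d i) * sqrt (?d i))\<^sup>2"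
    by simp
  also have "\<dots> \<le> (\<Sum>i\<in>I. (sqrt (1 / ?d i))\<^sup>2) * (\<Sum>i\<in>I. (sqrt (?d i))\<^sup>2)"
    by (rule Cauchy_Schwarz_ineq_sum)
  also have "\<dots> = (\<Sum>i\<in>I. 1 / ?d i) * (\<Sum>i\<in>I. ?d i)"
    by (simp add: real_sqrt_divide[symmetric] del: real_sqrt_divide)
  also have "\<dots> \<le> real k * (\<Sum>i\<in>I. ?d i)"
    using J(3) indep[OF J(1,2)] by (intro mult_right_mono sum_nonneg) auto
  finally show ?thesis .
qed

section \<open>Spherical codes and the kissing number\<close>

text \<open>The cosine bound is a parameter because the upper estimate needs codes with a bound
  slightly above \<open>1/2\<close>.\<close>

definition spherical_code :: "real \<Rightarrow> 'a::euclidean_space set \<Rightarrow> bool" where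
  "spherical_code c A \<longleftrightarrow> finite A \<and> A \<subseteq> sphere 0 1 \<and> pairwise (\<lambda>u v. u \<bullet> v \<le> c) A"

lemma spherical_code_subset: "spherical_code c A \<Longrightarrow> B \<subseteq> A \<Longrightarrow> spherical_code c B"
  by (auto simp: spherical_code_def finite_subset intro: pairwise_subset)

text \<open>The midpoint of two centres at distance below 2 lies in both balls; the converse is the
  triangle inequality.\<close>

lemma disjoint_unit_balls_iff:
  fixes a b :: "'a::euclidean_space"
  shows "ball a 1 \<inter> ball b 1 = {} \<longleftrightarrow> 2 \<le> dist a b"
proof
  assume "ball a 1 \<inter> ball b 1 = {}"
  then have "midpoint a b \<notin> ball a 1 \<inter> ball b 1"
    by simp
  then show "2 \<le> dist a b"
    by (auto simp: dist_midpoint)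
next
  assume "2 \<le> dist a b"
  then show "ball a 1 \<inter> ball b 1 = {}"
    by (auto simp: disjoint_iff) (metis dist_triangle_less_add dist_commute not_le one_add_one)
qed

lemma unit_dist_ge_1_iff:
  fixes u v :: "'a::euclidean_space"
  assumes "norm u = 1" "norm v = 1"
  shows "1 \<le> dist u v \<longleftrightarrow> u \<bullet> v \<le> 1/2"
proof -
  have "(dist u v)\<^sup>2 = 2 - 2 * (u \<bullet> v)"
    using assms by (simp add: dist_norm power2_norm_eq_inner inner_diff inner_commute norm_eq_1)
  moreover have "1 \<le> dist u v \<longleftrightarrow> 1\<^sup>2 \<le> (dist u v)\<^sup>2"
    by (rule power_mono_iff[symmetric]) auto
  ultimately show ?thesis by auto
qed

text \<open>Touching the central sphere puts a centre at distance at most 2 from the origin, and not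
  overlapping it at least 2. Halved centres are thus unit vectors, with mutual distances at least
  1.\<close>

lemma kissing_configuration_scaleR:
  "kissing_configuration ((*\<^sub>R) 2 ` A) \<longleftrightarrow> spherical_code (1/2) A" for A :: "'a::euclidean_space set"
proof -
  have inj: "inj ((*\<^sub>R) 2 :: 'a \<Rightarrow> 'a)"
    by (auto simp: inj_def)
  have d: "dist (2 *\<^sub>R a) (2 *\<^sub>R b) = 2 * dist a b" for a b :: 'a
    by (simp add: dist_norm flip: scaleR_diff_right)
  have touch: "sphere (2 *\<^sub>R a) 1 \<inter> sphere 0 1 \<noteq> {} \<and> ball (2 *\<^sub>R a) 1 \<inter> ball 0 1 = {} \<longleftrightarrow> norm a = 1"
    for a :: 'a
  proof -
    have "norm a \<le> 1" if "p \<in> sphere (2 *\<^sub>R a) 1 \<inter> sphere 0 1" for p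
      using that norm_triangle_ineq[of "2 *\<^sub>R a - p" p] by (simp add: dist_norm)
    moreover have "a \<in> sphere (2 *\<^sub>R a) 1 \<inter> sphere 0 1" if "norm a = 1"
    proof -
      have "2 *\<^sub>R a - a = a" by (simp add: scaleR_2)
      then show ?thesis using that by (simp add: dist_norm)
    qed
    ultimately show ?thesis
      unfolding disjoint_unit_balls_iff by fastforce
  qed
  have "kissing_configuration ((*\<^sub>R) 2 ` A) \<longleftrightarrow> finite A \<and> (\<forall>a\<in>A. norm a = 1) \<and>
      (\<forall>a\<in>A. \<forall>b\<in>A. a \<noteq> b \<longrightarrow> 1 \<le> dist a b)"
    using finite_image_iff[OF inj_on_subset[OF inj subset_UNIV], of A]
    unfolding kissing_configuration_def ball_simps(9) touch by (simp add: disjoint_unit_balls_iff d)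
  then show ?thesis
    using unit_dist_ge_1_iff[where 'a = 'a]
    unfolding spherical_code_def pairwise_def by (auto simp: subset_iff)
qed

lemma kissing_number_eq_Max:
  "kissing_number TYPE('a::euclidean_space) = Max {card A | A :: 'a set. spherical_code (1/2) A}"
proof -
  have "{card A | A :: 'a set. kissing_configuration A}
      = {card A | A :: 'a set. spherical_code (1/2) A}"
  proof (intro equalityI subsetI; clarify)
    fix A :: "'a set" assume A: "kissing_configuration A"
    define B where "B = (*\<^sub>R) (1/2) ` A"
    have "A = (*\<^sub>R) 2 ` B"
      by (simp add: B_def image_image)
    moreover have "card ((*\<^sub>R) 2 ` B) = card B"
      by (intro card_image) (auto simp: inj_on_def)
    ultimately show "\<exists>B :: 'a set. card A = card B \<and> spherical_code (1/2) B"
      using A kissing_configuration_scaleR by metis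
  next
    fix A :: "'a set" assume A: "spherical_code (1/2) A"
    moreover have "card ((*\<^sub>R) 2 ` A) = card A"
      by (intro card_image) (auto simp: inj_on_def)
    ultimately show "\<exists>B :: 'a set. card A = card B \<and> kissing_configuration B"
      using kissing_configuration_scaleR by metis
  qed
  then show ?thesis
    by (simp add: kissing_number_def)
qed

text \<open>Finitely many balls of radius \<open>1/2\<close> cover the sphere, and each contains at
  most one point of a code, as code points are at least 1 apart.\<close>

lemma finite_spherical_code_cards:
  "finite {card A | A :: 'a::euclidean_space set. spherical_code (1/2) A}"
proof -
  obtain k :: "'a set" where k: "finite k" "sphere 0 1 \<subseteq> (\<Union>x\<in>k. ball x (1/2))"
    using compact_eq_totally_bounded[of "sphere (0 :: 'a) 1"] compact_sphere
    by (metis half_gt_zero zero_less_one)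
  have "card A \<le> card k" if A: "spherical_code (1/2) A" for A :: "'a set"
  proof -
    have "\<forall>a\<in>A. \<exists>x. x \<in> k \<and> dist x a < 1/2"
      using A k(2) by (auto simp: spherical_code_def subset_iff)
    then obtain f where f: "\<And>a. a \<in> A \<Longrightarrow> f a \<in> k \<and> dist (f a) a < 1/2"
      by metis
    have "inj_on f A"
    proof (rule inj_onI, rule ccontr)
      fix a b assume ab: "a \<in> A" "b \<in> A" "f a = f b" "a \<noteq> b"
      then have "1 \<le> dist a b"
        using A unit_dist_ge_1_iff[of a b] by (auto simp: spherical_code_def pairwise_def subset_iff)
      then show False
        using f[OF ab(1)] f[OF ab(2)] ab(3) dist_triangle3[of a b "f a"] by simp
    qed
    then show ?thesis
      using f k(1) by (intro card_inj_on_le[of f]) auto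
  qed
  then show ?thesis
    by (intro finite_subset[OF _ finite_atMost[of "card k"]]) auto
qed

lemma card_le_kissing_number:
  "spherical_code (1/2) A \<Longrightarrow> card A \<le> kissing_number TYPE('a)" for A :: "'a::euclidean_space set"
  unfolding kissing_number_eq_Max by (rule Max_ge[OF finite_spherical_code_cards]) blast

lemma kissing_number_pos: "0 < kissing_number TYPE('a::euclidean_space)"
proof -
  obtain u :: 'a where "norm u = 1"
    using vector_choose_size[of 1] by auto
  then have "spherical_code (1/2) {u}"
    by (simp add: spherical_code_def)
  from card_le_kissing_number[OF this] show ?thesis
    by simp
qed

lemma kissing_number_attained:
  obtains A :: "'a::euclidean_space set"
  where "spherical_code (1/2) A" "card A = kissing_number TYPE('a)"
proof -
  \<comment> \<open>The empty code ensures that the maximum is over a nonempty set.\<close>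
  have "spherical_code (1/2) ({} :: 'a set)"
    by (simp add: spherical_code_def)
  then have "Max {card A | A :: 'a set. spherical_code (1/2) A} \<in> {card A | A :: 'a set. spherical_code (1/2) A}"
    using finite_spherical_code_cards by (intro Max_in) blast+
  then show thesis
    unfolding kissing_number_eq_Max[symmetric] using that by auto
qed

section \<open>Compactness and relaxation of the angle condition\<close>

text \<open>Tychonoff over all of \<open>nat\<close>: indices from \<open>d\<close> on range over
  the compact singleton \<open>{undefined}\<close>.\<close>

lemma compact_tuples: "compact V \<Longrightarrow> compact (tuples V d)"
proof -
  assume V: "compact V"
  have "tuples V d = PiE UNIV (\<lambda>i. if i < d then V else {undefined})"
  proof (intro set_eqI)
    fix x :: "nat \<Rightarrow> 'a"
    have "(\<forall>i. x i \<in> (if i < d then V else {undefined})) \<longleftrightarrow>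
        (\<forall>i<d. x i \<in> V) \<and> (\<forall>i. \<not> i < d \<longrightarrow> x i = undefined)"
      by (auto split: if_splits)
    then show "x \<in> tuples V d \<longleftrightarrow> x \<in> PiE UNIV (\<lambda>i. if i < d then V else {undefined})"
      by (simp add: tuples_def PiE_iff extensional_def Ball_def)
  qed
  moreover have "compactin (product_topology (\<lambda>i. euclidean) UNIV)
      (PiE UNIV (\<lambda>i. if i < d then V else {undefined}))"
    unfolding compactin_PiE using V by (auto simp: compactin_euclidean_iff)
  ultimately show ?thesis
    by (simp add: euclidean_product_topology compactin_euclidean_iff)
qed

text \<open>
  By compactness, the total violation of the angle condition attains a positive minimum on tuples that are one too long.
\<close>

lemma kissing_number_relaxed:
  obtains \<eta> where "0 < \<eta>" "\<eta> < 1/2"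
    "\<And>A :: 'a::euclidean_space set. spherical_code (1/2 + \<eta>) A \<Longrightarrow> card A \<le> kissing_number TYPE('a)"
proof -
  define d where "d = Suc (kissing_number TYPE('a))"
  define P where "P = {p \<in> {..<d} \<times> {..<d}. fst p \<noteq> snd p}"
  define g where "g = (\<lambda>x :: nat \<Rightarrow> 'a. \<Sum>p\<in>P. max 0 (x (fst p) \<bullet> x (snd p) - 1/2))"
  have P: "finite P" "card P \<le> d\<^sup>2"
    using card_mono[of "{..<d} \<times> {..<d}" P] by (auto simp: P_def power2_eq_square)
  have "continuous_on (tuples (sphere 0 1) d) g"
    unfolding g_def
    by (intro continuous_on_sum continuous_on_max continuous_on_const continuous_on_diff
        continuous_on_inner continuous_on_subset[OF continuous_on_product_coordinates] subset_UNIV)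
  moreover have "tuples (sphere (0 :: 'a) 1) d \<noteq> {}"
    by (auto simp: tuples_def PiE_eq_empty_iff)
  moreover have "compact (tuples (sphere (0 :: 'a) 1) d)"
    by (intro compact_tuples compact_sphere)
  ultimately obtain x0 where x0: "x0 \<in> tuples (sphere 0 1) d"
    "\<And>x. x \<in> tuples (sphere 0 1) d \<Longrightarrow> g x0 \<le> g x"
    using continuous_attains_inf by metis
  \<comment> \<open>A tuple without violation would be a code of \<open>d\<close> points, one more
    than the kissing number. Its entries are distinct because equal unit vectors have inner product
    1.\<close>
  have "g x0 \<noteq> 0"
  proof
    assume "g x0 = 0"
    then have "\<forall>p\<in>P. max 0 (x0 (fst p) \<bullet> x0 (snd p) - 1/2) = 0"
      unfolding g_def using P by (subst (asm) sum_nonneg_eq_0_iff) auto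
    then have ip: "x0 i \<bullet> x0 j \<le> 1/2" if "i < d" "j < d" "i \<noteq> j" for i j
      using that by (fastforce simp: P_def max_def split: if_splits)
    have unit: "x0 i \<bullet> x0 i = 1" "norm (x0 i) = 1" if "i < d" for i
      using x0(1) that by (auto simp: tuples_def PiE_iff norm_eq_1[symmetric])
    have "inj_on x0 {..<d}"
      using ip unit by (intro inj_onI) (metis lessThan_iff not_le less_numeral_extra(1) half_gt_zero_iff field_sum_of_halves less_add_same_cancel1)
    moreover have "spherical_code (1/2) (x0 ` {..<d})"
      using ip unit by (auto simp: spherical_code_def pairwise_def)
    ultimately show False
      using card_le_kissing_number by (fastforce simp: card_image d_def)
  qed
  moreover have "0 \<le> g x0"
    unfolding g_def by (intro sum_nonneg) auto
  ultimately have pos: "0 < g x0" by simp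
  \<comment> \<open>There are at most \<open>d\<^sup>2\<close> index pairs, so violations of at most
    \<eta> each add up to at most half the minimum \<open>g x0\<close>. The cap \<open>1/4\<close>
    keeps \<eta> below \<open>1/2\<close>.\<close>
  define \<eta> where "\<eta> = min (1/4) (g x0 / (2 * d\<^sup>2))"
  have d2: "0 < real (d\<^sup>2)" by (simp add: d_def)
  show thesis
  proof (rule that)
    show \<eta>: "0 < \<eta>" "\<eta> < 1/2"
      using pos d2 by (auto simp: \<eta>_def)
    fix A :: "'a set" assume A: "spherical_code (1/2 + \<eta>) A"
    show "card A \<le> kissing_number TYPE('a)"
    proof (rule ccontr)
      assume "\<not> ?thesis"
      then have "d \<le> card A"
        by (simp add: d_def)
      then obtain B where B: "B \<subseteq> A" "card B = d" "finite B"
        by (rule obtain_subset_with_card_n)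
      have code: "spherical_code (1/2 + \<eta>) B"
        using spherical_code_subset A B(1) .
      obtain h where h: "bij_betw h {..<d} B"
        using ex_bij_betw_nat_finite[OF B(3)] B(2) by (auto simp: atLeast0LessThan)
      define x where "x = restrict h {..<d}"
      have hB: "h i \<in> B" if "i < d" for i
        using bij_betwE[OF h] that by blast
      have x: "x \<in> tuples (sphere 0 1) d"
        using hB code by (auto simp: x_def tuples_def spherical_code_def)
      have "max 0 (x (fst p) \<bullet> x (snd p) - 1/2) \<le> \<eta>" if p: "p \<in> P" for p
      proof -
        have "h (fst p) \<noteq> h (snd p)" "h (fst p) \<in> B" "h (snd p) \<in> B"
          using p hB inj_onD[OF bij_betw_imp_inj_on[OF h], of "fst p" "snd p"] by (auto simp: P_def)
        then have "h (fst p) \<bullet> h (snd p) \<le> 1/2 + \<eta>"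
          using code by (simp add: spherical_code_def pairwise_def)
        then show ?thesis
          using p \<eta>(1) by (auto simp: P_def x_def)
      qed
      then have "g x \<le> real (card P) * \<eta>"
        unfolding g_def by (rule sum_bounded_above)
      also have "\<dots> \<le> real (d\<^sup>2) * (g x0 / (2 * d\<^sup>2))"
        using P(2) \<eta> pos by (intro mult_mono) (auto simp: \<eta>_def simp del: of_nat_power)
      also have "\<dots> < g x0"
        using pos d2 by simp
      finally show False
        using x0(2)[OF x] by simp
    qed
  qed
qed

section \<open>Convergence to the kissing number\<close>

lemma kissing_number_le_nu_bound:
  "ereal (real (kissing_number TYPE('a))) \<le> nu_bound (sphere (0 :: 'a::euclidean_space) 1) sphere_adj r"
proof -
  obtain A :: "'a set" where A: "spherical_code (1/2) A" "card A = kissing_number TYPE('a)"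
    by (rule kissing_number_attained)
  have "A \<noteq> {}"
    using A(2) kissing_number_pos[where 'a = 'a] by force
  then have "ereal (real (card A)) \<le> nu_bound (sphere (0 :: 'a) 1) sphere_adj r"
    using A(1) by (intro card_stable_le_nu_bound) (auto simp: spherical_code_def pairwise_def sphere_adj_def not_less)
  then show ?thesis
    by (simp add: A(2))
qed

text \<open>
  The feasible kernel rises from \<open>-1\<close> to \<open>l - 1\<close> as the inner product grows from \<open>1/2\<close> to
  \<open>1/2 + \<eta>\<close>, so it dominates the Motzkin--Straus kernel of the relaxed graph.
\<close>

lemma gamma_bound_sphere_le:
  assumes "0 < \<epsilon>"
  shows "\<exists>r. gamma_bound (sphere (0 :: 'a::euclidean_space) 1) sphere_adj r
    \<le> ereal (real (kissing_number TYPE('a)) + \<epsilon>)"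
proof -
  define k where "k = kissing_number TYPE('a)"
  have k: "0 < k"
    by (simp add: k_def kissing_number_pos)
  define l where "l = real k + \<epsilon>"
  have l: "0 < l"
    using assms by (simp add: l_def)
  obtain \<eta> where \<eta>: "0 < \<eta>" "\<eta> < 1/2"
    "\<And>A :: 'a set. spherical_code (1/2 + \<eta>) A \<Longrightarrow> card A \<le> k"
    using kissing_number_relaxed[where 'a = 'a] unfolding k_def by blast
  define K where "K = (\<lambda>u v :: 'a. l * min 1 (max 0 ((u \<bullet> v - 1/2) / \<eta>)) - 1)"
  have K_ge: "K u v \<ge> l * of_bool (1/2 + \<eta> < u \<bullet> v) - 1" for u v
  proof (cases "1/2 + \<eta> < u \<bullet> v")
    case True
    then have "1 \<le> (u \<bullet> v - 1/2) / \<eta>"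
      using \<eta>(1) by (simp add: field_simps)
    then show ?thesis
      using True by (simp add: K_def)
  next
    case False
    have "0 \<le> min 1 (max 0 ((u \<bullet> v - 1/2) / \<eta>))"
      by simp
    then show ?thesis
      using False l by (simp add: K_def)
  qed
  have K_diag: "K u u = l - 1" if "norm u = 1" for u
  proof -
    \<comment> \<open>As \<eta> is below \<open>1/2\<close>, the ramp has reached its cap at inner
      product 1.\<close>
    have "1 \<le> (u \<bullet> u - 1/2) / \<eta>"
      using \<eta>(1,2) that by (simp add: field_simps norm_eq_1)
    then show ?thesis
      by (simp add: K_def)
  qed
  have K_nonadj: "K u v = -1" if "u \<bullet> v \<le> 1/2" for u v
  proof -
    have "(u \<bullet> v - 1/2) / \<eta> \<le> 0"
      using \<eta>(1) that by (simp add: divide_nonpos_pos)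
    then show ?thesis
      by (simp add: K_def)
  qed
  have K_kernel: "K \<in> kernels (sphere 0 1)"
    unfolding kernels_def K_def using \<eta>(1)
    by (auto simp: inner_commute split_beta intro!: continuous_intros)
  \<comment> \<open>This size of \<open>r\<close> makes the loss from omitting the diagonal, of
    order \<open>d\<close>, smaller than the gain \<open>\<epsilon> * d\<^sup>2\<close> from Turan's
    inequality.\<close>
  obtain r :: nat where r: "l * k / \<epsilon> \<le> r"
    using real_arch_simple by blast
  have "0 \<le> (\<Sum>i<r + 2. \<Sum>j\<in>{..<r + 2} - {i}. K (x i) (x j))"
    if x: "x \<in> tuples (sphere 0 1) (r + 2)" for x
  proof -
    define d where "d = r + 2"
    define R where "R = (\<lambda>i j. 1/2 + \<eta> < x i \<bullet> x j)"
    define S where "S = (\<Sum>i<d. real (card {j \<in> {..<d}. R i j}))"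
    have unit: "norm (x i) = 1" if "i < d" for i
      using x that by (simp add: tuples_def PiE_iff d_def)
    have refl: "R i i" if "i < d" for i
      using unit[OF that] \<eta>(2) by (simp add: R_def norm_eq_1)
    have "(real (card {..<d}))\<^sup>2 \<le> real k * (\<Sum>i<d. real (card {j \<in> {..<d}. R i j}))"
    proof (rule turan)
      fix J assume J: "J \<subseteq> {..<d}" "pairwise (\<lambda>i j. \<not> R i j) J"
      \<comment> \<open>The relation \<open>R\<close> lives on indices, since a tuple may repeat
        points. Equal points are related, so an independent \<open>J\<close> indexes distinct
        ones.\<close>
      have inj: "inj_on x J"
      proof (rule inj_onI, rule ccontr)
        fix i j assume ij: "i \<in> J" "j \<in> J" "x i = x j" "i \<noteq> j"
        then have "\<not> R i j" "R i i"
          using J refl by (auto simp: pairwise_def)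
        then show False
          using ij(3) by (simp add: R_def)
      qed
      have "finite J"
        using J(1) by (rule finite_subset) simp
      moreover have "x ` J \<subseteq> sphere 0 1"
        using J(1) unit by (auto simp: subset_iff)
      moreover have "pairwise (\<lambda>u v. u \<bullet> v \<le> 1/2 + \<eta>) (x ` J)"
        using J(2) by (auto simp: pairwise_def R_def not_less)
      ultimately have "spherical_code (1/2 + \<eta>) (x ` J)"
        by (simp add: spherical_code_def)
      then show "card J \<le> k"
        using \<eta>(3) by (metis card_image[OF inj])
    qed (auto simp: refl, simp add: R_def inner_commute)
    then have S: "(real d)\<^sup>2 \<le> real k * S"
      by (simp add: S_def)
    \<comment> \<open>The lower bound \<open>K_ge\<close> is summed over the full row, and the
      diagonal entry \<open>l - 1\<close> is then removed.\<close>
    have row: "l * real (card {j \<in> {..<d}. R i j}) - real d - (l - 1) \<le> (\<Sum>j\<in>{..<d} - {i}. K (x i) (x j))"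
      if i: "i < d" for i
    proof -
      have "l * real (card {j \<in> {..<d}. R i j}) - real d = (\<Sum>j<d. l * of_bool (R i j) - 1)"
        by (simp add: sum_subtractf flip: sum_distrib_left)
          (simp add: of_bool_def sum.If_cases Int_def)
      also have "\<dots> \<le> (\<Sum>j<d. K (x i) (x j))"
        unfolding R_def by (intro sum_mono K_ge)
      also have "\<dots> = (\<Sum>j\<in>{..<d} - {i}. K (x i) (x j)) + (l - 1)"
        using i by (simp add: sum.remove[of "{..<d}" i] K_diag unit)
      finally show ?thesis by simp
    qed
    have "l * k \<le> \<epsilon> * d"
      using r assms by (simp add: d_def field_simps)
    then have "0 \<le> real d * (\<epsilon> * d - k * (l - 1))"
      by (intro mult_nonneg_nonneg) (auto simp: algebra_simps)
    also have "\<dots> = l * (real d)\<^sup>2 - k * (real d)\<^sup>2 - k * d * (l - 1)"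
      by (simp add: l_def algebra_simps power2_eq_square)
    \<comment> \<open>The factor \<open>k\<close> carried along lets Turan's inequality replace
      \<open>(real d)\<^sup>2\<close> by \<open>k * S\<close> in the term with coefficient
      \<open>l\<close>.\<close>
    also have "\<dots> \<le> l * (k * S) - k * (real d)\<^sup>2 - k * d * (l - 1)"
      using mult_left_mono[OF S, of l] l by simp
    also have "\<dots> = k * (\<Sum>i<d. l * real (card {j \<in> {..<d}. R i j}) - real d - (l - 1))"
    proof -
      have "(\<Sum>i<d. l * real (card {j \<in> {..<d}. R i j}) - real d - (l - 1))
          = l * S - (real d)\<^sup>2 - d * (l - 1)"
        unfolding S_def by (simp only: sum_subtractf sum_distrib_left sum_constant card_lessThan power2_eq_square)
          (simp add: algebra_simps)
      then show ?thesis
        by (simp only:) (simp add: algebra_simps)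
    qed
    also have "\<dots> \<le> k * (\<Sum>i<d. \<Sum>j\<in>{..<d} - {i}. K (x i) (x j))"
      using row by (intro mult_left_mono sum_mono) auto
    finally show ?thesis
      using k by (simp add: zero_le_mult_iff d_def)
  qed
  then have "K \<in> cone_C (sphere 0 1) r"
    by (rule cone_C_I[OF K_kernel])
  then have "gamma_bound (sphere (0 :: 'a) 1) sphere_adj r \<le> ereal l"
    unfolding gamma_bound_def stability_bound_def
    by (intro Inf_lower) (auto intro!: bexI[of _ K] K_diag K_nonadj simp: sphere_adj_def not_less)
  then show ?thesis
    unfolding l_def k_def by blast
qed

theorem proposition5:
  assumes "CARD('n::finite) \<ge> 2"
  shows "decseq (gamma_bound (sphere (0 :: real ^ 'n) 1) sphere_adj) \<and>
    gamma_bound (sphere (0 :: real ^ 'n) 1) sphere_adj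
      \<longlonglongrightarrow> ereal (real (kissing_number TYPE(real ^ 'n))) \<and>
    decseq (nu_bound (sphere (0 :: real ^ 'n) 1) sphere_adj) \<and>
    nu_bound (sphere (0 :: real ^ 'n) 1) sphere_adj
      \<longlonglongrightarrow> ereal (real (kissing_number TYPE(real ^ 'n)))"
proof -
  define \<gamma> where "\<gamma> = gamma_bound (sphere (0 :: real ^ 'n) 1) sphere_adj"
  define \<nu> where "\<nu> = nu_bound (sphere (0 :: real ^ 'n) 1) sphere_adj"
  define k where "k = ereal (real (kissing_number TYPE(real ^ 'n)))"
  have dec: "decseq \<gamma>" "decseq \<nu>"
    by (simp_all add: \<gamma>_def \<nu>_def decseq_gamma_bound decseq_nu_bound)
  have le: "k \<le> \<nu> r" "\<nu> r \<le> \<gamma> r" for r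
    by (simp_all add: k_def \<gamma>_def \<nu>_def kissing_number_le_nu_bound nu_bound_le_gamma_bound)
  \<comment> \<open>Decreasing sequences tend to their infima, and \<open>k\<close> bounds both from
    below, so only the larger infimum needs an upper bound.\<close>
  have "(INF r. \<gamma> r) \<le> k"
  proof (rule ereal_le_epsilon2)
    fix e :: real assume "0 < e"
    then obtain r where "\<gamma> r \<le> k + ereal e"
      using gamma_bound_sphere_le[of e, where 'a = "real ^ 'n"] by (auto simp: \<gamma>_def k_def)
    then show "(INF r. \<gamma> r) \<le> k + ereal e"
      by (rule INF_lower2[OF UNIV_I])
  qed
  moreover have "k \<le> (INF r. \<nu> r)"
    by (intro INF_greatest le)
  moreover have "(INF r. \<nu> r) \<le> (INF r. \<gamma> r)"
    by (intro INF_mono') (rule le)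
  ultimately have "(INF r. \<gamma> r) = k" "(INF r. \<nu> r) = k"
    by auto
  then have "\<gamma> \<longlonglongrightarrow> k" "\<nu> \<longlonglongrightarrow> k"
    using LIMSEQ_INF[OF dec(1)] LIMSEQ_INF[OF dec(2)] by simp_all
  with dec show ?thesis
    by (simp add: \<gamma>_def \<nu>_def k_def)
qed

end
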